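(* Let $L>0$, let $f\colon\mathbb{R}^n\to\mathbb{R}$ be convex and $L$-smooth, let $g\colon\mathbb{R}^n\to\mathbb{R}\cup\{\infty\}$ be closed, convex, and proper, and let $F=f+g$. Assume $F$ has a minimizer $x_\star$. Let $K\ge1$ be an integer, let $x_0\in\mathbb{R}^n$, and let $x_{2K}$ be the final iterate of the method FISTA+FISTA-G (defined in the context) started from $x_0$, which runs $K$ iterations of FISTA followed by $K$ iterations of FISTA-G. Then $$\min\|\partial F(x_{2K}^{\oplus})\|^2\le 4\|\tilde\nabla_L F(x_{2K})\|^2\le\frac{528L^2}{(K+2)^4}\|x_0-x_\star\|^2.$$
   Context: $\|\cdot\|$ is the Euclidean norm. $f$ is $L$-smooth if it is differentiable and $\nabla f$ is $L$-Lipschitz. The prox-grad step is $$x^{\oplus}=\operatorname*{arg\,min}_{y\in\mathbb{R}^n}\left\{f(x)+\langle\nabla f(x),y-x\rangle+g(y)+\frac L2\|y-x\|^2\right\},$$ and $\tilde\nabla_L F(x):=-L(x^{\oplus}-x)$. $\partial F(x)$ is the subdifferential of the convex function $F$ and $\min\|\partial F(x)\|^2=\min\{\|u\|^2\mid u\in\partial F(x)\}$. FISTA from a starting point $y_0$: set $y_{-1}^{\oplus}:=y_0$, $\theta_0=1$, $\theta_{k+1}=\frac{1+\sqrt{1+4\theta_k^2}}{2}$, and $$y_{k+1}=y_k^{\oplus}+\frac{\theta_k-1}{\theta_{k+1}}(y_k^{\oplus}-y_{k-1}^{\oplus}),\qquad k=0,1,\dots,K-1.$$ Its output after $K$ iterations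 is $y_K^{\oplus}$. FISTA-G from a starting point $w_0$: set $\varphi_{K+1}=0$, $\varphi_K=1$, $$\varphi_{k}=\frac{\varphi_{k+2}^2-\varphi_{k+1}\varphi_{k+2}+2\varphi_{k+1}^2+(\varphi_{k+1}-\varphi_{k+2})\sqrt{\varphi_{k+2}^2+3\varphi_{k+1}^2}}{\varphi_{k+1}+\varphi_{k+2}},\qquad k=K-1,\dots,0,-1,$$ $w_{-1}^{\oplus}:=w_0$, and $$w_{k+1}=w_k^{\oplus}+\frac{\varphi_{k+1}-\varphi_{k+2}}{\varphi_k-\varphi_{k+1}}(w_k^{\oplus}-w_{k-1}^{\oplus}),\qquad k=0,1,\dots,K-1.$$ Its final iterate is $w_K$. FISTA+FISTA-G from $x_0$: run $K$ iterations of FISTA from $y_0=x_0$, then run $K$ iterations of FISTA-G from $w_0=y_K^{\oplus}$; the final iterate is $x_{2K}:=w_K$. *)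

theory Defs
  imports "HOL-Analysis.Analysis"
begin

definition gradient :: "('a::real_inner \<Rightarrow> real) \<Rightarrow> 'a \<Rightarrow> 'a" where
  "gradient f x = (THE D. GDERIV f x :> D)"

definition smooth_with :: "real \<Rightarrow> ('a::real_inner \<Rightarrow> real) \<Rightarrow> bool" where
  "smooth_with L f \<longleftrightarrow> (\<forall>x. f differentiable (at x)) \<and> L-lipschitz_on UNIV (gradient f)"

text \<open>
  Functions with values in \<open>\<real> \<union> {\<infinity>}\<close> are \<open>ereal\<close>-valued functions avoiding \<open>-\<infinity>\<close>; convexity
  and closedness are those of the epigraph, since the library's \<open>convex_on\<close> is restricted to
  real-valued functions.
\<close>

definition ereal_epigraph :: "('a \<Rightarrow> ereal) \<Rightarrow> ('a \<times> real) set" where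
  "ereal_epigraph g = {(x, r). g x \<le> ereal r}"

definition closed_fun :: "('a::topological_space \<Rightarrow> ereal) \<Rightarrow> bool" where
  "closed_fun g \<longleftrightarrow> closed (ereal_epigraph g)"

definition convex_fun :: "('a::real_vector \<Rightarrow> ereal) \<Rightarrow> bool" where
  "convex_fun g \<longleftrightarrow> convex (ereal_epigraph g)"

definition proper_fun :: "('a \<Rightarrow> ereal) \<Rightarrow> bool" where
  "proper_fun g \<longleftrightarrow> (\<forall>x. g x \<noteq> -\<infinity>) \<and> (\<exists>x. g x \<noteq> \<infinity>)"

definition subdifferential :: "('a::real_inner \<Rightarrow> ereal) \<Rightarrow> 'a \<Rightarrow> 'a set" where
  "subdifferential F x = {u. \<forall>y. F x + ereal (u \<bullet> (y - x)) \<le> F y}"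

definition prox_grad ::
    "real \<Rightarrow> ('a::real_inner \<Rightarrow> real) \<Rightarrow> ('a \<Rightarrow> ereal) \<Rightarrow> 'a \<Rightarrow> 'a" where
  "prox_grad L f g x =
     arg_min_on (\<lambda>y. ereal (f x + gradient f x \<bullet> (y - x)) + g y
                     + ereal (L / 2 * (norm (y - x))\<^sup>2)) UNIV"

definition grad_mapping ::
    "real \<Rightarrow> ('a::real_inner \<Rightarrow> real) \<Rightarrow> ('a \<Rightarrow> ereal) \<Rightarrow> 'a \<Rightarrow> 'a" where
  "grad_mapping L f g x = (- L) *\<^sub>R (prox_grad L f g x - x)"

text \<open>
  The iteration \<open>z\<^sub>k\<^sub>+\<^sub>1 = T z\<^sub>k + b\<^sub>k (T z\<^sub>k - T z\<^sub>k\<^sub>-\<^sub>1)\<close> from \<open>z\<^sub>0\<close>,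
  where at \<open>k = 0\<close> the missing \<open>T z\<^sub>k\<^sub>-\<^sub>1\<close> is read as \<open>z\<^sub>0\<close>.
\<close>

fun momentum :: "('a::real_vector \<Rightarrow> 'a) \<Rightarrow> (nat \<Rightarrow> real) \<Rightarrow> 'a \<Rightarrow> nat \<Rightarrow> 'a" where
  "momentum T b z0 0 = z0"
| "momentum T b z0 (Suc 0) = T z0 + b 0 *\<^sub>R (T z0 - z0)"
| "momentum T b z0 (Suc (Suc k)) =
     T (momentum T b z0 (Suc k))
     + b (Suc k) *\<^sub>R (T (momentum T b z0 (Suc k)) - T (momentum T b z0 k))"

fun theta :: "nat \<Rightarrow> real" where
  "theta 0 = 1"
| "theta (Suc k) = (1 + sqrt (1 + 4 * (theta k)\<^sup>2)) / 2"

definition fista ::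
    "real \<Rightarrow> ('a::real_inner \<Rightarrow> real) \<Rightarrow> ('a \<Rightarrow> ereal) \<Rightarrow> 'a \<Rightarrow> nat \<Rightarrow> 'a" where
  "fista L f g y0 =
     momentum (prox_grad L f g) (\<lambda>k. (theta k - 1) / theta (Suc k)) y0"

text \<open>
  The coefficients \<open>\<phi>\<^sub>K\<^sub>+\<^sub>1, \<phi>\<^sub>K, \<dots>, \<phi>\<^sub>-\<^sub>1\<close> are generated by descending index and the recursion does
  not involve \<open>K\<close>, so \<open>phi_rev j\<close> is \<open>\<phi>\<close> at index \<open>K + 1 - j\<close>. See \<open>phi_rec\<close> for the
  recursion in the original indexing.
\<close>

fun phi_rev :: "nat \<Rightarrow> real" where
  "phi_rev 0 = 0"
| "phi_rev (Suc 0) = 1"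
| "phi_rev (Suc (Suc j)) =
     (let p1 = phi_rev (Suc j); p2 = phi_rev j in
      (p2\<^sup>2 - p1 * p2 + 2 * p1\<^sup>2 + (p1 - p2) * sqrt (p2\<^sup>2 + 3 * p1\<^sup>2)) / (p1 + p2))"

definition phi :: "nat \<Rightarrow> int \<Rightarrow> real" where
  "phi K k = phi_rev (nat (int K + 1 - k))"

lemma phi_end: "phi K (int K + 1) = 0" "phi K (int K) = 1"
  by (simp_all add: phi_def)

lemma phi_rec:
  assumes "k \<le> int K - 1"
  shows "phi K k =
    ((phi K (k + 2))\<^sup>2 - phi K (k + 1) * phi K (k + 2) + 2 * (phi K (k + 1))\<^sup>2
      + (phi K (k + 1) - phi K (k + 2)) * sqrt ((phi K (k + 2))\<^sup>2 + 3 * (phi K (k + 1))\<^sup>2))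
    / (phi K (k + 1) + phi K (k + 2))"
proof -
  have "nat (int K + 1 - k) = Suc (Suc (nat (int K + 1 - (k + 2))))"
    and "nat (int K + 1 - (k + 1)) = Suc (nat (int K + 1 - (k + 2)))"
    using assms by linarith+
  then show ?thesis
    by (simp only: phi_def phi_rev.simps Let_def)
qed

definition fista_g ::
    "real \<Rightarrow> ('a::real_inner \<Rightarrow> real) \<Rightarrow> ('a \<Rightarrow> ereal) \<Rightarrow> nat \<Rightarrow> 'a \<Rightarrow> nat \<Rightarrow> 'a" where
  "fista_g L f g K w0 =
     momentum (prox_grad L f g)
       (\<lambda>k. (phi K (int k + 1) - phi K (int k + 2)) / (phi K (int k) - phi K (int k + 1))) w0"

definition fista_fista_g ::
    "real \<Rightarrow> ('a::real_inner \<Rightarrow> real) \<Rightarrow> ('a \<Rightarrow> ereal) \<Rightarrow> nat \<Rightarrow> 'a \<Rightarrow> 'a" where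
  "fista_fista_g L f g K x0 = fista_g L f g K (prox_grad L f g (fista L f g x0 K)) K"

end

theory Submission
  imports Defs
begin

text \<open>
  Everything rests on the prox-grad inequality
  \<open>F x\<^sup>\<oplus> + L \<langle>x - x\<^sup>\<oplus>, y - x\<rangle> + L/2 \<parallel>x - x\<^sup>\<oplus>\<parallel>\<^sup>2 \<le> F y\<close>. For FISTA it gives the classical rate
  \<open>2 L \<parallel>x\<^sub>0 - x\<^sub>\<star>\<parallel>\<^sup>2 / (K + 2)\<^sup>2\<close> on function values.

  For FISTA-G put \<open>a\<^sub>n = \<phi>\<^sub>n - \<phi>\<^sub>n\<^sub>+\<^sub>1\<close> and \<open>\<tau>\<^sub>n = (\<phi>\<^sub>n + \<phi>\<^sub>n\<^sub>+\<^sub>1) / a\<^sub>n\<^sup>2\<close>. The recursion for \<open>\<phi>\<close> says exactly that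
  \<open>\<tau>\<^sub>n\<^sub>+\<^sub>1 - \<tau>\<^sub>n = 1 / a\<^sub>n\<close>. Weighting the inequality at \<open>w\<^sub>n\<close> towards \<open>w\<^sub>n\<^sub>-\<^sub>1\<^sup>\<oplus>\<close> by \<open>\<tau>\<^sub>n\<close> and towards
  \<open>w\<^sub>K\<^sup>\<oplus>\<close> by \<open>1 / a\<^sub>n\<close>, all quadratic terms telescope except \<open>L/2 \<parallel>w\<^sub>K - w\<^sub>K\<^sup>\<oplus>\<parallel>\<^sup>2\<close>, which is therefore at
  most \<open>\<tau>\<^sub>0 (F w\<^sub>0 - F w\<^sub>K\<^sup>\<oplus>)\<close>. Finally \<open>m = \<tau> a\<close> satisfies \<open>m'\<^sup>2 = m\<^sup>2 + m + 1\<close> and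
  \<open>\<tau>' = \<tau> m' / (1 + m')\<close> in descending index, so \<open>m\<close> grows at least like \<open>K / 2\<close> and
  \<open>\<tau>\<^sub>0 \<le> 30 / (K + 2)\<^sup>2\<close>.
\<close>

subsection \<open>The coefficients of FISTA-G\<close>

text \<open>With p, q the two preceding values and R the square root, the recursion has increment (q
  - p) (q - p + R) / (q + p), so positivity of increments propagates.\<close>

lemma phi_rev_strict: "0 \<le> phi_rev j \<and> phi_rev j < phi_rev (Suc j)"
proof (induction j)
  case 0
  show ?case by simp
next
  case (Suc j)
  let ?p = "phi_rev j" and ?q = "phi_rev (Suc j)" and ?r = "phi_rev (Suc (Suc j))"
  let ?R = "sqrt (?p\<^sup>2 + 3 * ?q\<^sup>2)"
  have "?r - ?q = (?q - ?p) * (?q - ?p + ?R) / (?q + ?p)"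
    using Suc by (simp add: Let_def field_simps power2_eq_square)
  moreover have "\<dots> > 0"
    using Suc by (intro divide_pos_pos mult_pos_pos add_pos_nonneg) auto
  ultimately show ?case
    using Suc by linarith
qed

text \<open>For j = K - n, this and the next two definitions are the \<open>a\<close>,
  \<open>\<tau>\<close> and m of the overview at index n.\<close>

definition phi_gap :: "nat \<Rightarrow> real" where
  "phi_gap j = phi_rev (Suc j) - phi_rev j"

definition phi_weight :: "nat \<Rightarrow> real" where
  "phi_weight j = (phi_rev (Suc j) + phi_rev j) / (phi_gap j)\<^sup>2"

definition phi_slope :: "nat \<Rightarrow> real" where
  "phi_slope j = (phi_rev (Suc j) + phi_rev j) / phi_gap j"

lemma phi_gap_pos: "phi_gap j > 0"
  using phi_rev_strict[of j] by (simp add: phi_gap_def)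

lemma phi_slope_pos: "phi_slope j > 0"
  using phi_rev_strict[of j] by (simp add: phi_gap_def phi_slope_def)

lemma phi_weight_eq: "phi_weight j = phi_slope j / phi_gap j"
  by (simp add: phi_weight_def phi_slope_def power2_eq_square)

lemma phi_weight_pos: "phi_weight j > 0"
  using phi_slope_pos[of j] phi_gap_pos[of j] by (simp add: phi_weight_eq)

lemma phi_gap_Suc:
  "phi_gap (Suc j) = phi_gap j * (1 + sqrt ((phi_slope j)\<^sup>2 + phi_slope j + 1)) / phi_slope j"
proof -
  let ?p = "phi_rev j" and ?q = "phi_rev (Suc j)" and ?r = "phi_rev (Suc (Suc j))"
  have pq: "0 \<le> ?p" "?p < ?q" "0 < ?q" "?q + ?p \<noteq> 0" "?q - ?p \<noteq> 0"
    using phi_rev_strict[of j] by auto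
  let ?R = "sqrt (?p\<^sup>2 + 3 * ?q\<^sup>2)"
  have 1: "?r - ?q = (?q - ?p) * (?q - ?p + ?R) / (?q + ?p)"
    using pq by (simp add: Let_def field_simps power2_eq_square)
  \<comment> \<open>With s = q + p and a = q - p, the radicand p^2 + 3 q^2 is s^2 + s a + a^2, so
    divided by a^2 it depends only on the ratio s / a.\<close>
  have "(phi_slope j)\<^sup>2 + phi_slope j + 1 = (?p\<^sup>2 + 3 * ?q\<^sup>2) / (?q - ?p)\<^sup>2"
  proof -
    have "s\<^sup>2 / a\<^sup>2 + s / a + 1 = (s\<^sup>2 + s * a + a\<^sup>2) / a\<^sup>2" if "a \<noteq> 0" for s a :: real
      using that by (simp add: field_simps power2_eq_square)
    moreover have "(?q + ?p)\<^sup>2 + (?q + ?p) * (?q - ?p) + (?q - ?p)\<^sup>2 = ?p\<^sup>2 + 3 * ?q\<^sup>2"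
      by (simp add: algebra_simps power2_eq_square)
    ultimately show ?thesis
      using pq by (simp add: phi_slope_def phi_gap_def power_divide)
  qed
  then have 2: "sqrt ((phi_slope j)\<^sup>2 + phi_slope j + 1) = ?R / (?q - ?p)"
    using pq by (simp add: real_sqrt_divide)
  show ?thesis
  proof -
    have *: "a * (a + R) / s = a * (1 + R / a) / (s / a)" if "a > 0" "s > 0" for a s R :: real
      using that by (simp add: field_simps)
    show ?thesis
      unfolding 2 unfolding phi_slope_def phi_gap_def 1 by (rule *) (use pq in auto)
  qed
qed

text \<open>Since 2 q = (m + 1) a, the new slope is 1 + 2 q / a' = 1 + m (m + 1) / (1 + s), with s
  the claimed root; m (m + 1) = s^2 - 1 collapses this to s.\<close>

lemma phi_slope_Suc: "phi_slope (Suc j) = sqrt ((phi_slope j)\<^sup>2 + phi_slope j + 1)"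
proof -
  let ?m = "phi_slope j" and ?a = "phi_gap j" and ?a' = "phi_gap (Suc j)"
  let ?s = "sqrt (?m\<^sup>2 + ?m + 1)"
  note pos = phi_slope_pos[of j] phi_gap_pos[of j] phi_gap_pos[of "Suc j"]
  have s: "?s > 0" "?s * ?s = ?m\<^sup>2 + ?m + 1"
  proof -
    have "?m\<^sup>2 + ?m + 1 > 0"
      using pos(1) by (intro add_pos_pos) auto
    then show "?s > 0" "?s * ?s = ?m\<^sup>2 + ?m + 1"
      by (simp_all only: real_sqrt_gt_0_iff real_sqrt_mult_self abs_of_pos)
  qed
  have "phi_slope (Suc j) = 1 + (?m + 1) * ?a / ?a'"
  proof -
    have "?m * ?a = phi_rev (Suc j) + phi_rev j"
      using pos(2) by (simp add: phi_slope_def)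
    then have "(?m + 1) * ?a = 2 * phi_rev (Suc j)"
      by (simp add: distrib_right) (simp add: phi_gap_def)
    moreover have "phi_rev (Suc (Suc j)) = phi_rev (Suc j) + ?a'"
      by (simp add: phi_gap_def del: phi_rev.simps)
    ultimately show ?thesis
      using pos(3) by (simp add: phi_slope_def add_divide_distrib del: phi_rev.simps)
  qed
  also have "(?m + 1) * ?a / ?a' = (?m + 1) * ?m / (1 + ?s)"
    unfolding phi_gap_Suc using pos(2) by simp
  also have "(?m + 1) * ?m = (?s - 1) * (1 + ?s)"
    using s(2) by (simp add: algebra_simps power2_eq_square)
  also have "1 + (?s - 1) * (1 + ?s) / (1 + ?s) = ?s"
  proof -
    have "1 + ?s \<noteq> 0" using s(1) by linarith
    then show ?thesis by simp
  qed
  finally show ?thesis .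
qed

text \<open>Both follow from a' = a (1 + m') / m and \<open>\<tau>\<close> = m / a. The second is
  the form of the recursion that makes the FISTA-G potential telescope.\<close>

lemma phi_weight_Suc:
  "phi_weight (Suc j) = phi_weight j * (phi_slope (Suc j) / (1 + phi_slope (Suc j)))"
  "phi_weight j - phi_weight (Suc j) = 1 / phi_gap (Suc j)"
proof -
  note pos = phi_slope_pos[of j] phi_gap_pos[of j] phi_gap_pos[of "Suc j"] phi_slope_pos[of "Suc j"]
  have a: "phi_gap (Suc j) = phi_gap j * (1 + phi_slope (Suc j)) / phi_slope j"
    by (simp add: phi_gap_Suc phi_slope_Suc)
  show 1: "phi_weight (Suc j) = phi_weight j * (phi_slope (Suc j) / (1 + phi_slope (Suc j)))"
    using pos unfolding phi_weight_eq a by (simp add: field_simps)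
  show "phi_weight j - phi_weight (Suc j) = 1 / phi_gap (Suc j)"
  proof -
    have *: "m / a - m / a * (m' / (1 + m')) = 1 / (a * (1 + m') / m)" if "m > 0" "m' > 0" "a > 0"
      for m m' a :: real
    proof -
      have "m / a - m / a * (m' / (1 + m')) = m / a * (1 - m' / (1 + m'))"
        by (simp add: right_diff_distrib)
      also have "1 - m' / (1 + m') = 1 / (1 + m')"
        using that by (simp add: field_simps)
      finally show ?thesis by simp
    qed
    show ?thesis
      unfolding 1 unfolding phi_weight_eq a by (rule *) (use pos in auto)
  qed
qed

text \<open>Since m^2 + m + 1 >= (m + 1/2)^2, every step adds at least 1/2 to the initial slope
  1.\<close>

lemma phi_slope_ge: "phi_slope j \<ge> (real j + 2) / 2"
proof (induction j)
  case 0
  show ?case by (simp add: phi_slope_def phi_gap_def)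
next
  case (Suc j)
  have "(phi_slope j + 1/2)\<^sup>2 \<le> (phi_slope j)\<^sup>2 + phi_slope j + 1"
    by (simp add: power2_eq_square field_simps)
  then have "phi_slope j + 1/2 \<le> phi_slope (Suc j)"
    unfolding phi_slope_Suc by (rule real_le_rsqrt)
  moreover have "(real (Suc j) + 2) / 2 = (real j + 2) / 2 + 1/2"
    by (simp add: field_simps)
  ultimately show ?case
    using Suc by linarith
qed

text \<open>The potential \<open>m\<^sup>2 + 3 m + 7/2\<close> is chosen so that its growth compensates the factor
  \<open>m / (1 + m)\<close> by which the weights decrease.\<close>

lemma phi_weight_potential:
  "phi_weight j * ((phi_slope j)\<^sup>2 + 3 * phi_slope j + 7/2) \<le> 15/2"
proof (induction j)
  case 0
  show ?case by (simp add: phi_slope_def phi_gap_def phi_weight_def)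
next
  case (Suc j)
  let ?m = "phi_slope j" and ?m' = "phi_slope (Suc j)"
  note pos = phi_slope_pos[of j] phi_slope_pos[of "Suc j"]
  have m: "?m \<ge> 1" using phi_slope_ge[of j] by simp
  have sq: "?m'\<^sup>2 = ?m\<^sup>2 + ?m + 1"
    using pos by (simp add: phi_slope_Suc add_nonneg_nonneg)
  have "(?m + 1/2)\<^sup>2 \<le> ?m\<^sup>2 + ?m + 1"
    by (simp add: power2_eq_square field_simps)
  then have "?m + 1/2 \<le> ?m'"
    unfolding phi_slope_Suc by (rule real_le_rsqrt)
  \<comment> \<open>The inequality wanted below expands to (2 m - 1) (m' - m - 1/2) >= 0; the
    constant 7/2 in the potential is what makes it factor.\<close>
  then have "(2 * ?m - 1) * (?m + 1/2) \<le> (2 * ?m - 1) * ?m'"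
    using m by (intro mult_left_mono) auto
  then have k: "2 * ?m\<^sup>2 + ?m' \<le> 2 * ?m * ?m' + 1/2"
    by (simp add: algebra_simps power2_eq_square)
  have "?m' * (?m'\<^sup>2 + 3 * ?m' + 7/2) = ?m'\<^sup>2 * ?m' + 3 * ?m'\<^sup>2 + 7/2 * ?m'"
    by (simp add: algebra_simps power2_eq_square)
  also have "\<dots> \<le> (?m\<^sup>2 + 3 * ?m + 7/2) * (1 + ?m')"
    using k unfolding sq by (simp add: algebra_simps add_divide_distrib)
  finally have "?m' / (1 + ?m') * (?m'\<^sup>2 + 3 * ?m' + 7/2) \<le> ?m\<^sup>2 + 3 * ?m + 7/2"
    using pos by (simp add: field_simps)
  then have "phi_weight j * (?m' / (1 + ?m') * (?m'\<^sup>2 + 3 * ?m' + 7/2))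
      \<le> phi_weight j * (?m\<^sup>2 + 3 * ?m + 7/2)"
    using phi_weight_pos[of j] by (intro mult_left_mono) auto
  with Suc show ?case
    unfolding phi_weight_Suc(1) mult.assoc by (rule order_trans[rotated])
qed

text \<open>The potential dominates m^2 >= (j + 2)^2 / 4, and 4 * 15/2 = 30.\<close>

lemma phi_weight_le: "phi_weight j \<le> 30 / (real j + 2)\<^sup>2"
proof -
  let ?m = "phi_slope j"
  have "((real j + 2) / 2)\<^sup>2 \<le> ?m\<^sup>2"
    using phi_slope_ge[of j] by (intro power_mono) auto
  then have "(real j + 2)\<^sup>2 / 4 \<le> ?m\<^sup>2 + 3 * ?m + 7/2"
    using phi_slope_pos[of j] by (simp add: power_divide)
  moreover have "phi_weight j \<ge> 0"
    using phi_weight_pos[of j] by simp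
  ultimately have "phi_weight j * ((real j + 2)\<^sup>2 / 4) \<le> 15/2"
    using phi_weight_potential[of j] by (meson mult_left_mono order_trans)
  then show ?thesis by (simp add: field_simps)
qed

subsection \<open>Rates from the prox-grad inequality\<close>

text \<open>Reading the missing earlier step at k = 0 as \<open>z0\<close> lets
  \<open>momentum_Suc\<close> treat the first iteration like all others.\<close>

definition previous_step :: "('a::real_vector \<Rightarrow> 'a) \<Rightarrow> (nat \<Rightarrow> real) \<Rightarrow> 'a \<Rightarrow> nat \<Rightarrow> 'a" where
  "previous_step T b z0 k = (case k of 0 \<Rightarrow> z0 | Suc j \<Rightarrow> T (momentum T b z0 j))"

lemma previous_step_simps [simp]:
  "previous_step T b z0 0 = z0"
  "previous_step T b z0 (Suc k) = T (momentum T b z0 k)"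
  by (simp_all add: previous_step_def)

lemma momentum_Suc:
  "momentum T b z0 (Suc k) =
     previous_step T b z0 (Suc k) + b k *\<^sub>R (previous_step T b z0 (Suc k) - previous_step T b z0 k)"
  by (cases k) simp_all

section \<open>The function-value rate of FISTA\<close>

lemma theta_ge: "theta k \<ge> (real k + 2) / 2"
proof (induction k)
  case 0
  show ?case by simp
next
  case (Suc k)
  have "2 * theta k \<le> sqrt (1 + 4 * (theta k)\<^sup>2)"
    by (rule real_le_rsqrt) (simp add: power_mult_distrib)
  with Suc show ?case by simp
qed

lemma theta_ge_1: "theta k \<ge> 1"
  using theta_ge[of k] of_nat_0_le_iff[of k, where 'a = real] by (simp add: add_divide_distrib)

text \<open>The new term is the larger root of this quadratic. In the FISTA potential the identity
  turns the coefficient t (t - 1) of the old value gap into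
  \<open>(theta k)\<^sup>2\<close>.\<close>

lemma theta_Suc_sq: "(theta (Suc k))\<^sup>2 - theta (Suc k) = (theta k)\<^sup>2"
proof -
  have "(sqrt (1 + 4 * (theta k)\<^sup>2))\<^sup>2 = 1 + 4 * (theta k)\<^sup>2"
    by (simp add: add_nonneg_nonneg)
  then show ?thesis
    by (simp add: power2_eq_square algebra_simps)
qed

text \<open>The only property of the prox-grad step that the rates use: \<open>T\<close> abstracts \<open>x\<^sup>\<oplus>\<close> and \<open>h\<close> is
  the objective on its domain \<open>D\<close>.\<close>

locale prox_step =
  fixes T :: "'a::real_inner \<Rightarrow> 'a" and h :: "'a \<Rightarrow> real" and D :: "'a set" and L :: real
  assumes L_pos: "L > 0"
    and step_in: "T x \<in> D"
    and step_le: "y \<in> D \<Longrightarrow> h (T x) + L * ((x - T x) \<bullet> (y - x)) + L / 2 * (norm (x - T x))\<^sup>2 \<le> h y"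
begin

text \<open>The left side is a Lyapunov function, nonincreasing in k; at k = 0 the value
  \<open>theta 0 = 1\<close> removes the previous point.\<close>

lemma fista_potential:
  fixes y0 xs :: 'a
  defines "b \<equiv> \<lambda>k. (theta k - 1) / theta (Suc k)"
  defines "y \<equiv> momentum T b y0" and "p \<equiv> previous_step T b y0"
  assumes "xs \<in> D"
  shows "(theta k)\<^sup>2 * (h (T (y k)) - h xs)
           + L / 2 * (norm (theta k *\<^sub>R T (y k) - (theta k - 1) *\<^sub>R p k - xs))\<^sup>2
         \<le> L / 2 * (norm (y0 - xs))\<^sup>2"
proof (induction k)
  case 0
  have [simp]: "y 0 = y0" by (simp add: y_def)
  have "L / 2 * (norm (T y0 - xs))\<^sup>2
      = L / 2 * (norm (y0 - xs))\<^sup>2 + L * ((y0 - T y0) \<bullet> (xs - y0)) + L / 2 * (norm (y0 - T y0))\<^sup>2"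
    unfolding power2_norm_eq_inner by (simp add: inner_simps inner_commute algebra_simps)
  with step_le[OF \<open>xs \<in> D\<close>, of y0] show ?case by (simp add: add_divide_distrib)
next
  case (Suc k)
  define t where "t = theta (Suc k)"
  have t: "t \<ge> 1" "t\<^sup>2 - t = (theta k)\<^sup>2"
    using theta_ge_1 theta_Suc_sq by (simp_all only: t_def)
  define x P where "x = y (Suc k)" and "P = T (y k)"
  have [simp]: "p (Suc k) = P" by (simp add: P_def p_def y_def)
  have "t *\<^sub>R x = t *\<^sub>R P + (theta k - 1) *\<^sub>R (P - p k)"
    using t by (simp add: x_def y_def momentum_Suc P_def p_def b_def t_def[symmetric] scaleR_add_right del: theta.simps)
  \<comment> \<open>The momentum coefficient is chosen so that the auxiliary point of stage k is
    also this combination of the next iterate x and P.\<close>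
  then have u: "theta k *\<^sub>R P - (theta k - 1) *\<^sub>R p k - xs = t *\<^sub>R x - (t - 1) *\<^sub>R P - xs"
    by (simp add: algebra_simps)
  have "h (T x) + L * ((x - T x) \<bullet> (P - x)) + L / 2 * (norm (x - T x))\<^sup>2 \<le> h P"
    by (rule step_le) (simp add: P_def step_in)
  moreover have "h (T x) + L * ((x - T x) \<bullet> (xs - x)) + L / 2 * (norm (x - T x))\<^sup>2 \<le> h xs"
    by (rule step_le) fact
  \<comment> \<open>The inequalities towards P and towards \<open>xs\<close> get weights t (t - 1)
    and t, of total t^2.\<close>
  ultimately have "t * ((t - 1) * (h (T x) + L * ((x - T x) \<bullet> (P - x)) + L / 2 * (norm (x - T x))\<^sup>2)
        + (h (T x) + L * ((x - T x) \<bullet> (xs - x)) + L / 2 * (norm (x - T x))\<^sup>2))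
      \<le> t * ((t - 1) * h P + h xs)"
    using t by (intro mult_left_mono add_mono) auto
  moreover have "t * ((t - 1) * h P + h xs) = (theta k)\<^sup>2 * (h P - h xs) + t\<^sup>2 * h xs"
    unfolding t(2)[symmetric] by (simp add: algebra_simps power2_eq_square)
  \<comment> \<open>Passing from x to \<open>T x\<close> replaces w by w - t G with G = x - T x;
    expanding the square yields exactly the terms of the weighted inequalities.\<close>
  moreover have "L / 2 * (norm (t *\<^sub>R T x - (t - 1) *\<^sub>R P - xs))\<^sup>2 + t\<^sup>2 * h (T x) =
      L / 2 * (norm (t *\<^sub>R x - (t - 1) *\<^sub>R P - xs))\<^sup>2
      + t * ((t - 1) * (h (T x) + L * ((x - T x) \<bullet> (P - x)) + L / 2 * (norm (x - T x))\<^sup>2)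
        + (h (T x) + L * ((x - T x) \<bullet> (xs - x)) + L / 2 * (norm (x - T x))\<^sup>2))"
  proof -
    define G w where "G = x - T x" and "w = t *\<^sub>R x - (t - 1) *\<^sub>R P - xs"
    have 1: "t *\<^sub>R T x - (t - 1) *\<^sub>R P - xs = w - t *\<^sub>R G"
      by (simp add: G_def w_def algebra_simps)
    have 2: "(t - 1) * (G \<bullet> (P - x)) + G \<bullet> (xs - x) = - (G \<bullet> w)"
      by (simp add: w_def inner_simps algebra_simps)
    have 3: "(norm (w - t *\<^sub>R G))\<^sup>2 = (norm w)\<^sup>2 - 2 * t * (G \<bullet> w) + t\<^sup>2 * (norm G)\<^sup>2"
      unfolding power2_norm_eq_inner
      by (simp add: inner_simps inner_commute algebra_simps power2_eq_square)
    have 4: "t * ((t - 1) * (h (T x) + L * (G \<bullet> (P - x)) + L / 2 * (norm G)\<^sup>2)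
        + (h (T x) + L * (G \<bullet> (xs - x)) + L / 2 * (norm G)\<^sup>2))
      = t\<^sup>2 * h (T x) + L * t * ((t - 1) * (G \<bullet> (P - x)) + G \<bullet> (xs - x)) + t\<^sup>2 * (L / 2 * (norm G)\<^sup>2)"
      by (simp add: algebra_simps power2_eq_square diff_divide_distrib)
    show ?thesis
      unfolding 1 G_def[symmetric] w_def[symmetric] 3 4 2 by (simp add: algebra_simps)
  qed
  ultimately have "t\<^sup>2 * (h (T x) - h xs) + L / 2 * (norm (t *\<^sub>R T x - (t - 1) *\<^sub>R P - xs))\<^sup>2
      \<le> (theta k)\<^sup>2 * (h P - h xs) + L / 2 * (norm (t *\<^sub>R x - (t - 1) *\<^sub>R P - xs))\<^sup>2"
    by (simp add: right_diff_distrib)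
  with Suc show ?case
    by (simp add: u P_def[symmetric] x_def[symmetric] t_def[symmetric] del: theta.simps)
qed

lemma fista_rate:
  assumes "xs \<in> D" and "y = momentum T (\<lambda>k. (theta k - 1) / theta (Suc k)) y0 K"
  shows "h (T y) - h xs \<le> 2 * L / (real K + 2)\<^sup>2 * (norm (y0 - xs))\<^sup>2"
proof -
  have *: "(theta K)\<^sup>2 * (h (T y) - h xs) \<le> L / 2 * (norm (y0 - xs))\<^sup>2"
    using fista_potential[OF assms(1), where ?y0.0 = y0 and k = K] L_pos
    unfolding assms(2) by (smt (verit) mult_nonneg_nonneg half_gt_zero zero_le_power2)
  \<comment> \<open>\<open>xs\<close> is any point of \<open>D\<close>, so the gap may be negative;
    the lower bound on theta can be multiplied by it only when it is not.\<close>
  show ?thesis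
  proof (cases "h (T y) - h xs \<ge> 0")
    case True
    have "((real K + 2) / 2)\<^sup>2 \<le> (theta K)\<^sup>2"
      using theta_ge[of K] by (intro power_mono) auto
    then have "((real K + 2) / 2)\<^sup>2 * (h (T y) - h xs) \<le> L / 2 * (norm (y0 - xs))\<^sup>2"
      using * mult_right_mono[OF _ True] order_trans by blast
    then show ?thesis by (simp add: field_simps)
  next
    case False
    moreover have "2 * L / (real K + 2)\<^sup>2 * (norm (y0 - xs))\<^sup>2 \<ge> 0"
      using L_pos by simp
    ultimately show ?thesis by linarith
  qed
qed

section \<open>The gradient-mapping rate of FISTA-G\<close>

lemma fista_g_potential:
  fixes \<phi> \<tau> :: "nat \<Rightarrow> real" and w0 :: 'a and K :: nat
  defines "a \<equiv> \<lambda>n. \<phi> n - \<phi> (Suc n)"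
  defines "b \<equiv> \<lambda>n. a (Suc n) / a n"
  defines "w \<equiv> momentum T b w0" and "p \<equiv> previous_step T b w0"
  assumes "w0 \<in> D" and "\<phi> (Suc K) = 0" and "\<phi> K = 1"
    and a_pos: "\<And>n. n \<le> K \<Longrightarrow> a n > 0"
    and weight: "\<And>n. n \<le> K \<Longrightarrow> \<tau> n * (a n)\<^sup>2 = \<phi> n + \<phi> (Suc n)"
    and weight_Suc: "\<And>n. n < K \<Longrightarrow> \<tau> (Suc n) = \<tau> n + 1 / a n"
    and weight_nonneg: "\<And>n. n \<le> K \<Longrightarrow> \<tau> n \<ge> 0"
  shows "L / 2 * (norm (w K - T (w K)))\<^sup>2 \<le> \<tau> 0 * (h w0 - h (T (w K)))"
proof -
  \<comment> \<open>S is the last displacement of the prox-grad points over its \<open>a\<close>,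
    and 0 initially. Then w_n = p_n + a_n S_n and p_(n+1) = p_n + a_n S_(n+1) share base point and
    scale.\<close>
  define S where "S n = (case n of 0 \<Rightarrow> 0 | Suc m \<Rightarrow> (p (Suc m) - p m) /\<^sub>R a m)" for n
  define X where "X = T (w K)"
  have w_eq: "w n = p n + a n *\<^sub>R S n" if "n \<le> K" for n
  proof (cases n)
    case 0
    then show ?thesis by (simp add: S_def w_def p_def)
  next
    case (Suc m)
    then show ?thesis
      by (simp add: S_def w_def p_def b_def momentum_Suc divide_inverse)
  qed
  have p_Suc: "p (Suc n) = T (w n)" for n
    by (simp add: p_def w_def)
  have step: "p (Suc n) = p n + a n *\<^sub>R S (Suc n)" if "n \<le> K" for n
    using a_pos[OF that] by (simp add: S_def)
  have p_in: "p n \<in> D" for n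
    by (cases n) (simp_all add: p_def \<open>w0 \<in> D\<close> step_in)
  have grad: "w n - T (w n) = a n *\<^sub>R (S n - S (Suc n))" if "n \<le> K" for n
    using w_eq[OF that] step[OF that] p_Suc[of n] by (simp add: algebra_simps)

  \<comment> \<open>The inequality towards p_n, weighted by \<open>\<tau> n\<close>, which turns the
    factor (a_n)^2 into \<open>\<phi> n + \<phi> (Suc n)\<close>.\<close>
  have B: "\<tau> n * h (p (Suc n)) + L / 2 * (\<phi> n + \<phi> (Suc n)) * (S (Suc n) \<bullet> S (Suc n) - S n \<bullet> S n)
      \<le> \<tau> n * h (p n)" if n: "n \<le> K" for n
  proof -
    have "h (T (w n)) + L * ((w n - T (w n)) \<bullet> (p n - w n)) + L / 2 * (norm (w n - T (w n)))\<^sup>2 \<le> h (p n)"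
      by (rule step_le[OF p_in])
    moreover have "L * ((w n - T (w n)) \<bullet> (p n - w n)) + L / 2 * (norm (w n - T (w n)))\<^sup>2
        = L / 2 * (a n)\<^sup>2 * (S (Suc n) \<bullet> S (Suc n) - S n \<bullet> S n)"
      unfolding grad[OF n] unfolding w_eq[OF n] power2_norm_eq_inner
      by (simp add: inner_simps inner_commute algebra_simps power2_eq_square)
    ultimately have "\<tau> n * (h (p (Suc n)) + L / 2 * (a n)\<^sup>2 * (S (Suc n) \<bullet> S (Suc n) - S n \<bullet> S n)) \<le> \<tau> n * h (p n)"
      using weight_nonneg[OF n] by (intro mult_left_mono) (simp_all add: p_Suc add.assoc)
    then show ?thesis
      unfolding weight[OF n, symmetric] by (simp add: algebra_simps diff_divide_distrib)
  qed

  \<comment> \<open>The left side is nonincreasing in n; at n = 0 its second summand vanishes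
    because S is 0 there.\<close>
  have inv: "\<tau> n * (h (p n) - h X) + L * (\<phi> n * (S n \<bullet> S n) - S n \<bullet> (X - p n)) \<le> \<tau> 0 * (h w0 - h X)"
    if "n \<le> K" for n
    using that
  proof (induction n)
    case 0
    show ?case by (simp add: S_def p_def)
  next
    case (Suc n)
    then have n: "n \<le> K" "n < K" by auto
    define V where "V = X - p n"
    note a = a_pos[OF n(1)]
    have V': "X - p (Suc n) = V - a n *\<^sub>R S (Suc n)"
      using step[OF n(1)] by (simp add: V_def)
    have Xw: "X - w n = V - a n *\<^sub>R S n"
      using w_eq[OF n(1)] by (simp add: V_def)
    have "h (p (Suc n)) + L * ((w n - T (w n)) \<bullet> (X - w n)) + L / 2 * (norm (w n - T (w n)))\<^sup>2 \<le> h X"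
      unfolding p_Suc by (rule step_le) (simp add: X_def step_in)
    moreover have "L * ((w n - T (w n)) \<bullet> (X - w n)) + L / 2 * (norm (w n - T (w n)))\<^sup>2
      = a n * (L * (S n \<bullet> V - S (Suc n) \<bullet> V)
                 + L * a n / 2 * (S (Suc n) \<bullet> S (Suc n) - S n \<bullet> S n))"
      unfolding grad[OF n(1)] Xw power2_norm_eq_inner
      by (simp add: inner_simps inner_commute algebra_simps power2_eq_square)
    ultimately have "a n * (L * (S n \<bullet> V - S (Suc n) \<bullet> V)
        + L * a n / 2 * (S (Suc n) \<bullet> S (Suc n) - S n \<bullet> S n)) \<le> h X - h (p (Suc n))"
      by linarith
    \<comment> \<open>The inequality towards X gets weight 1 / a_n, the increment of
      \<open>\<tau>\<close>. Added to B it gives the squares the coefficient L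
      \<open>\<phi> n\<close>, since
      \<open>\<phi> n + \<phi> (Suc n) + a n = 2 * \<phi> n\<close>.\<close>
    then have A: "1 / a n * (h (p (Suc n)) - h X) + L * (S n \<bullet> V - S (Suc n) \<bullet> V)
        + L * a n / 2 * (S (Suc n) \<bullet> S (Suc n) - S n \<bullet> S n) \<le> 0"
      using a by (simp add: field_simps)
    have "\<tau> (Suc n) * (h (p (Suc n)) - h X)
        + L * (\<phi> (Suc n) * (S (Suc n) \<bullet> S (Suc n)) - S (Suc n) \<bullet> (X - p (Suc n)))
      \<le> \<tau> n * (h (p n) - h X) + L * (\<phi> n * (S n \<bullet> S n) - S n \<bullet> V)"
      using A B[OF n(1)] unfolding weight_Suc[OF n(2)] V'
      by (simp add: a_def inner_simps algebra_simps add_divide_distrib diff_divide_distrib)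
    then show ?case
      using Suc.IH n by (simp add: V_def)
  qed

  \<comment> \<open>At n = K the target X is itself p_(K+1), so B alone is added to the invariant;
    what remains is L/2 times the squared norm of S_K - S_(K+1).\<close>
  have "a K = 1" using assms by (simp add: a_def)
  then have "\<tau> K = 1" using weight[of K] assms by simp
  have X: "X = p (Suc K)" by (simp add: X_def p_Suc)
  have V: "X - p K = S (Suc K)"
    using step[of K] \<open>a K = 1\<close> by (simp add: X)
  have "L / 2 * (norm (w K - T (w K)))\<^sup>2 = L / 2 * (S (Suc K) \<bullet> S (Suc K) - S K \<bullet> S K)
      + L * (S K \<bullet> S K - S K \<bullet> S (Suc K))"
    unfolding grad[OF order_refl] \<open>a K = 1\<close> power2_norm_eq_inner
    by (simp add: inner_simps inner_commute algebra_simps)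
  also have "\<dots> \<le> \<tau> 0 * (h w0 - h X)"
    using inv[OF order_refl] B[OF order_refl] \<open>\<tau> K = 1\<close> \<open>\<phi> K = 1\<close> \<open>\<phi> (Suc K) = 0\<close>
    by (simp add: V X[symmetric] algebra_simps)
  finally show ?thesis by (simp add: X_def)
qed

end

text \<open>Index reversal: n in the method is j = K - n in \<open>phi_rev\<close>, so the initial
  weight \<open>\<tau> 0\<close> is \<open>phi_weight K\<close>.\<close>

lemma (in prox_step) fista_g_step:
  fixes K :: nat and w0 :: 'a
  defines "w \<equiv> momentum T (\<lambda>k. (phi K (int k + 1) - phi K (int k + 2))
                                / (phi K (int k) - phi K (int k + 1))) w0 K"
  assumes "w0 \<in> D"
  shows "L / 2 * (norm (w - T w))\<^sup>2 \<le> phi_weight K * (h w0 - h (T w))"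
proof -
  define \<phi> where "\<phi> n = phi K (int n)" for n
  \<comment> \<open>Two equations, since subtraction truncates: at n = K the first one with
    \<open>Suc n\<close> for n would give \<open>phi_rev (Suc 0)\<close> instead of
    \<open>phi_rev 0\<close>.\<close>
  have \<phi>: "\<phi> n = phi_rev (Suc (K - n))" "\<phi> (Suc n) = phi_rev (K - n)" if "n \<le> K" for n
  proof -
    have "nat (int K + 1 - int n) = Suc (K - n)" "nat (int K + 1 - int (Suc n)) = K - n"
      using that by linarith+
    then show "\<phi> n = phi_rev (Suc (K - n))" "\<phi> (Suc n) = phi_rev (K - n)"
      by (simp_all only: \<phi>_def phi_def)
  qed
  have gap: "\<phi> n - \<phi> (Suc n) = phi_gap (K - n)" if "n \<le> K" for n
    using that by (simp only: \<phi> phi_gap_def)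
  have w: "w = momentum T (\<lambda>n. (\<phi> (Suc n) - \<phi> (Suc (Suc n))) / (\<phi> n - \<phi> (Suc n))) w0 K"
    by (simp add: w_def \<phi>_def add.commute)
  have "L / 2 * (norm (w - T w))\<^sup>2 \<le> phi_weight (K - 0) * (h w0 - h (T w))"
    unfolding w
  proof (rule fista_g_potential)
    show "w0 \<in> D" by fact
    show "\<phi> (Suc K) = 0" "\<phi> K = 1"
      using \<phi>[of K] by simp_all
    show "\<phi> n - \<phi> (Suc n) > 0" if "n \<le> K" for n
      using that by (simp only: gap phi_gap_pos)
    show "phi_weight (K - n) * (\<phi> n - \<phi> (Suc n))\<^sup>2 = \<phi> n + \<phi> (Suc n)" if "n \<le> K" for n
      unfolding gap[OF that] unfolding \<phi>[OF that] phi_weight_def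
      using phi_gap_pos[of "K - n"] by simp
    show "phi_weight (K - Suc n) = phi_weight (K - n) + 1 / (\<phi> n - \<phi> (Suc n))" if "n < K" for n
    proof -
      have "K - n = Suc (K - Suc n)" using that by simp
      then show ?thesis
        using that phi_weight_Suc(2)[of "K - Suc n"] by (simp add: gap)
    qed
    show "phi_weight (K - n) \<ge> 0" for n
      using phi_weight_pos[of "K - n"] by simp
  qed
  then show ?thesis by simp
qed

subsection \<open>The prox-grad step\<close>

text \<open>The derivative is the limit of right difference quotients, each at most c. Along
  segments this turns convexity into first-order inequalities.\<close>

lemma derivative_le_chord:
  fixes q :: "real \<Rightarrow> real"
  assumes "(q has_real_derivative d) (at 0)"
    and "\<And>t. 0 < t \<Longrightarrow> t \<le> 1 \<Longrightarrow> q t - q 0 \<le> t * c"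
  shows "d \<le> c"
proof (rule tendsto_upperbound)
  show "((\<lambda>t. (q t - q 0) / (t - 0)) \<longlongrightarrow> d) (at_right 0)"
    using assms(1) unfolding has_field_derivative_iff by (rule filterlim_mono) (auto simp: at_le)
  have "\<forall>\<^sub>F t in at_right 0. 0 < t \<and> t < (1::real)"
    by (auto intro: eventually_at_right_less eventually_conj eventually_at_rightI[of 0 1])
  then show "\<forall>\<^sub>F t in at_right 0. (q t - q 0) / (t - 0) \<le> c"
    by eventually_elim (use assms(2) in \<open>auto simp: divide_le_eq mult.commute\<close>)
qed simp

lemma GDERIV_line:
  assumes "GDERIV q (p + t *\<^sub>R v) :> d"
  shows "((\<lambda>s. q (p + s *\<^sub>R v)) has_real_derivative d \<bullet> v) (at t)"
proof -
  have "((\<lambda>s. p + s *\<^sub>R v) has_derivative (\<lambda>s. s *\<^sub>R v)) (at t)"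
    by (auto intro!: derivative_eq_intros)
  from has_derivative_compose[OF this assms[unfolded gderiv_def]] show ?thesis
    by (simp add: has_field_derivative_def inner_commute mult_commute_abs)
qed

text \<open>\<open>gradient\<close> is a definite description, so existence and uniqueness are both
  due; the Riesz representative of the derivative is \<open>adjoint f' 1\<close>.\<close>

lemma GDERIV_gradient:
  fixes f :: "'a::euclidean_space \<Rightarrow> real"
  assumes "f differentiable (at x)"
  shows "GDERIV f x :> gradient f x"
  unfolding gradient_def
proof (rule theI')
  obtain f' where f': "(f has_derivative f') (at x)"
    using assms by (auto simp: differentiable_def)
  then have "f' = (\<lambda>h. h \<bullet> adjoint f' 1)"
    using adjoint_works[OF has_derivative_linear[OF f'], of _ 1] by (simp add: fun_eq_iff)
  with f' have "GDERIV f x :> adjoint f' 1"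
    by (simp add: gderiv_def)
  moreover have "D = D'" if "GDERIV f x :> D" "GDERIV f x :> D'" for D D'
    using has_derivative_unique[OF that[unfolded gderiv_def]] by (metis vector_eq_ldot)
  ultimately show "\<exists>!D. GDERIV f x :> D" by blast
qed

lemma convex_gradient_le:
  assumes "convex_on UNIV f" and "GDERIV f x :> d"
  shows "f x + d \<bullet> (y - x) \<le> f y"
proof -
  have "d \<bullet> (y - x) \<le> f y - f x"
  proof (rule derivative_le_chord)
    show "((\<lambda>t. f (x + t *\<^sub>R (y - x))) has_real_derivative d \<bullet> (y - x)) (at 0)"
      by (rule GDERIV_line) (simp add: assms)
    fix t :: real
    assume "0 < t" "t \<le> 1"
    then have "f ((1 - t) *\<^sub>R x + t *\<^sub>R y) \<le> (1 - t) * f x + t * f y"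
      by (intro convex_onD[OF assms(1)]) auto
    moreover have "(1 - t) *\<^sub>R x + t *\<^sub>R y = x + t *\<^sub>R (y - x)"
      by (simp add: algebra_simps)
    ultimately show "f (x + t *\<^sub>R (y - x)) - f (x + 0 *\<^sub>R (y - x)) \<le> t * (f y - f x)"
      by (simp add: algebra_simps)
  qed
  then show ?thesis by simp
qed

text \<open>The descent lemma: along the segment from x, f minus its quadratic model is
  nonincreasing, by the Lipschitz bound on the gradient.\<close>

lemma smooth_upper_bound:
  fixes f :: "'a::euclidean_space \<Rightarrow> real"
  assumes "smooth_with L f"
  shows "f y \<le> f x + gradient f x \<bullet> (y - x) + L / 2 * (norm (y - x))\<^sup>2"
proof -
  define v where "v = y - x"
  define q where "q t = f (x + t *\<^sub>R v) - t * (gradient f x \<bullet> v) - L / 2 * t\<^sup>2 * (norm v)\<^sup>2" for t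
  have "q 1 \<le> q 0"
  proof (rule DERIV_nonpos_imp_nonincreasing[where f = q])
    fix t :: real
    assume t: "0 \<le> t" "t \<le> 1"
    have "GDERIV f (x + t *\<^sub>R v) :> gradient f (x + t *\<^sub>R v)"
      using assms by (intro GDERIV_gradient) (auto simp: smooth_with_def)
    then have "(q has_real_derivative gradient f (x + t *\<^sub>R v) \<bullet> v - gradient f x \<bullet> v
        - L * t * (norm v)\<^sup>2) (at t)"
      unfolding q_def by (auto intro!: derivative_eq_intros GDERIV_line)
    moreover have "gradient f (x + t *\<^sub>R v) \<bullet> v - gradient f x \<bullet> v \<le> L * t * (norm v)\<^sup>2"
    proof -
      have "gradient f (x + t *\<^sub>R v) \<bullet> v - gradient f x \<bullet> v
          \<le> norm (gradient f (x + t *\<^sub>R v) - gradient f x) * norm v"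
        unfolding inner_diff_left[symmetric] by (rule norm_cauchy_schwarz)
      also have "\<dots> \<le> (L * norm (t *\<^sub>R v)) * norm v"
        using assms lipschitz_onD[of L UNIV "gradient f" "x + t *\<^sub>R v" x]
        by (intro mult_right_mono) (auto simp: smooth_with_def dist_norm)
      finally show ?thesis
        using t by (simp add: power2_eq_square mult_ac)
    qed
    ultimately show "\<exists>d. (q has_real_derivative d) (at t) \<and> d \<le> 0"
      by (intro exI conjI) auto
  qed simp
  then show ?thesis by (simp add: q_def v_def)
qed

section \<open>Extended-valued convex functions and attainment of the minimum\<close>

lemma convex_fun_segment_le:
  assumes "convex_fun g" and "g x = ereal a" and "g y = ereal b" and "0 \<le> t" and "t \<le> 1"
  shows "g (x + t *\<^sub>R (y - x)) \<le> ereal (a + t * (b - a))"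
proof -
  have "(1 - t) *\<^sub>R (x, a) + t *\<^sub>R (y, b) \<in> ereal_epigraph g"
    using assms by (intro convexD[OF assms(1)[unfolded convex_fun_def]]) (auto simp: ereal_epigraph_def)
  moreover have "(1 - t) *\<^sub>R (x, a) + t *\<^sub>R (y, b) = (x + t *\<^sub>R (y - x), a + t * (b - a))"
    by (simp add: algebra_simps)
  ultimately show ?thesis by (simp add: ereal_epigraph_def)
qed

lemma finite_at_minimizer:
  assumes "proper_fun g" and "\<And>y. ereal (q p) + g p \<le> ereal (q y) + g y"
  shows "\<bar>g p\<bar> \<noteq> \<infinity>"
proof -
  obtain z where "g z \<noteq> \<infinity>" "g z \<noteq> -\<infinity>" "g p \<noteq> -\<infinity>"
    using assms(1) by (auto simp: proper_fun_def)
  with assms(2)[of z] show ?thesis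
    by (cases "g z"; cases "g p") auto
qed

text \<open>Applied twice: to \<open>f + g\<close>, where it gives the affine minorant of \<open>g\<close> that makes the prox-grad
  model coercive, and to the prox-grad model itself.\<close>

lemma minimizer_subgradient:
  assumes "proper_fun g" and "convex_fun g" and "GDERIV q p :> d"
    and min: "\<And>y. ereal (q p) + g p \<le> ereal (q y) + g y"
  shows "- d \<in> subdifferential g p"
  unfolding subdifferential_def
proof (intro CollectI allI)
  fix y
  obtain a where a: "g p = ereal a"
    using finite_at_minimizer[where q = q, OF assms(1) min] by auto
  show "g p + ereal (- d \<bullet> (y - p)) \<le> g y"
  proof (cases "g y")
    case (real b)
    have "- (d \<bullet> (y - p)) \<le> b - a"
    proof (rule derivative_le_chord)
      show "((\<lambda>t. - q (p + t *\<^sub>R (y - p))) has_real_derivative - (d \<bullet> (y - p))) (at 0)"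
        by (intro DERIV_minus GDERIV_line) (simp add: assms)
      fix t :: real
      assume t: "0 < t" "t \<le> 1"
      have "ereal (q p) + g p \<le> ereal (q (p + t *\<^sub>R (y - p))) + g (p + t *\<^sub>R (y - p))"
        by (rule min)
      also have "\<dots> \<le> ereal (q (p + t *\<^sub>R (y - p))) + ereal (a + t * (b - a))"
        using t by (intro add_left_mono convex_fun_segment_le[OF assms(2) a real]) auto
      finally show "- q (p + t *\<^sub>R (y - p)) - - q (p + 0 *\<^sub>R (y - p)) \<le> t * (b - a)"
        by (simp add: a)
    qed
    then show ?thesis by (simp add: a real)
  qed (use assms(1) in \<open>auto simp: proper_fun_def\<close>)
qed

text \<open>Coercivity made explicit: for s > 1 the constant C is at most C s, and a factor s
  cancels.\<close>

lemma quadratic_bound: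
  fixes L M C s :: real
  assumes "L > 0" and "M \<ge> 0" and "C \<ge> 0" and "s \<ge> 0" and "L / 2 * s\<^sup>2 \<le> C + M * s"
  shows "s \<le> 1 + 2 * (C + M) / L"
proof (cases "s \<le> 1")
  case True
  moreover have "2 * (C + M) / L \<ge> 0" using assms by simp
  ultimately show ?thesis by linarith
next
  case False
  then have "C * 1 \<le> C * s"
    using assms by (intro mult_left_mono) auto
  then have "(L / 2 * s) * s \<le> (C + M) * s"
    using assms(5) by (simp add: power2_eq_square distrib_right mult.assoc)
  then have "L / 2 * s \<le> C + M"
    using False by simp
  then have "s \<le> 2 * (C + M) / L"
    using assms(1) by (simp add: field_simps)
  then show ?thesis by simp
qed

text \<open>On the epigraph the model becomes a continuous function m of (y, r). Its sublevel set
  through (z, a) is closed, and bounded because the affine minorant given by u leaves the quadratic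
  term in control; compactness gives the minimum.\<close>

lemma prox_model_attains_min:
  fixes g :: "'a::euclidean_space \<Rightarrow> ereal"
  assumes "L > 0" and "proper_fun g" and "closed_fun g"
    and "\<bar>g z\<bar> \<noteq> \<infinity>" and u: "u \<in> subdifferential g z"
  shows "\<exists>p. \<forall>y. ereal (c + d \<bullet> (p - x)) + g p + ereal (L / 2 * (norm (p - x))\<^sup>2)
            \<le> ereal (c + d \<bullet> (y - x)) + g y + ereal (L / 2 * (norm (y - x))\<^sup>2)"
proof -
  obtain a where a: "g z = ereal a"
    using assms(4) by auto
  define m where "m = (\<lambda>(y, r). c + d \<bullet> (y - x) + r + L / 2 * (norm (y - x))\<^sup>2)"
  define S where "S = ereal_epigraph g \<inter> {w. m w \<le> m (z, a)}"
  have cont: "continuous_on A m" for A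
    unfolding m_def case_prod_beta by (intro continuous_intros)
  have "closed S"
    unfolding S_def using assms(3)
    by (intro closed_Int closed_Collect_le cont continuous_intros) (auto simp: closed_fun_def)
  define C where "C = \<bar>d \<bullet> (z - x) + L / 2 * (norm (z - x))\<^sup>2 + u \<bullet> (z - x)\<bar>"
  define B where "B = 1 + 2 * (C + (norm d + norm u)) / L"
  define R where "R = \<bar>a\<bar> + norm u * (B + norm (x - z)) + \<bar>m (z, a)\<bar> + \<bar>c\<bar> + norm d * B"
  have "S \<subseteq> cball x B \<times> cball 0 R"
  proof (rule subrelI)
    fix y r assume "(y, r) \<in> S"
    then have r: "g y \<le> ereal r" and mr: "m (y, r) \<le> m (z, a)"
      by (auto simp: S_def ereal_epigraph_def)
    have "g z + ereal (u \<bullet> (y - z)) \<le> ereal r"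
      using u r unfolding subdifferential_def by (blast intro: order_trans)
    then have lo: "a + u \<bullet> (y - z) \<le> r" by (simp add: a)
    have d: "\<bar>d \<bullet> (y - x)\<bar> \<le> norm d * norm (y - x)" and ux: "\<bar>u \<bullet> (y - x)\<bar> \<le> norm u * norm (y - x)"
      by (rule Cauchy_Schwarz_ineq2)+
    have "u \<bullet> (y - z) = u \<bullet> (y - x) - u \<bullet> (z - x)"
      by (simp add: inner_diff_right)
    moreover have "d \<bullet> (z - x) + L / 2 * (norm (z - x))\<^sup>2 + u \<bullet> (z - x) \<le> C"
      unfolding C_def by (rule abs_ge_self)
    moreover have "c + d \<bullet> (y - x) + r + L / 2 * (norm (y - x))\<^sup>2
        \<le> c + d \<bullet> (z - x) + a + L / 2 * (norm (z - x))\<^sup>2"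
      using mr by (simp add: m_def)
    ultimately have "L / 2 * (norm (y - x))\<^sup>2 \<le> C + norm d * norm (y - x) + norm u * norm (y - x)"
      using lo d ux by linarith
    then have "L / 2 * (norm (y - x))\<^sup>2 \<le> C + (norm d + norm u) * norm (y - x)"
      by (simp add: distrib_right)
    then have s: "norm (y - x) \<le> B"
      unfolding B_def using assms(1) by (intro quadratic_bound) (auto simp: C_def)
    have "B \<ge> 0" using s norm_ge_zero order_trans by blast
    have "\<bar>u \<bullet> (y - z)\<bar> \<le> norm u * norm (y - z)"
      by (rule Cauchy_Schwarz_ineq2)
    also have "\<dots> \<le> norm u * (B + norm (x - z))"
      using s norm_triangle_ineq[of "y - x" "x - z"] by (intro mult_left_mono) auto
    finally have 1: "\<bar>u \<bullet> (y - z)\<bar> \<le> norm u * (B + norm (x - z))" .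
    have 2: "\<bar>d \<bullet> (y - x)\<bar> \<le> norm d * B"
      using d s by (meson mult_left_mono norm_ge_zero order_trans)
    have "0 \<le> L / 2 * (norm (y - x))\<^sup>2" using assms(1) by simp
    moreover have "0 \<le> norm u * (B + norm (x - z))" "0 \<le> norm d * B"
      using \<open>B \<ge> 0\<close> by simp_all
    ultimately have "\<bar>r\<bar> \<le> R"
      using lo mr 1 2 unfolding R_def by (simp add: m_def)
    with s show "(y, r) \<in> cball x B \<times> cball 0 R"
      by (simp add: dist_norm norm_minus_commute)
  qed
  then have "bounded S"
    by (rule bounded_subset[rotated]) (intro bounded_Times bounded_cball)
  with \<open>closed S\<close> have "compact S"
    by (simp add: compact_eq_bounded_closed)
  moreover have za: "(z, a) \<in> S"
    by (simp add: S_def ereal_epigraph_def a)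
  ultimately obtain p r where pr: "(p, r) \<in> S" and least: "\<And>w. w \<in> S \<Longrightarrow> m (p, r) \<le> m w"
    using continuous_attains_inf[of S m] cont by fastforce
  \<comment> \<open>Points outside the sublevel set lose to (z, a), hence to (p, r); replacing r by
    \<open>g p\<close> only lowers the value.\<close>
  have "ereal (c + d \<bullet> (p - x)) + g p + ereal (L / 2 * (norm (p - x))\<^sup>2)
      \<le> ereal (c + d \<bullet> (y - x)) + g y + ereal (L / 2 * (norm (y - x))\<^sup>2)" for y
  proof (cases "g y")
    case (real b)
    have "m (p, r) \<le> m (y, b)"
    proof (cases "m (y, b) \<le> m (z, a)")
      case True
      then show ?thesis
        using real by (intro least) (simp add: S_def ereal_epigraph_def)
    next
      case False
      then show ?thesis using least[OF za] by simp
    qed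
    moreover have "ereal (c + d \<bullet> (p - x)) + g p + ereal (L / 2 * (norm (p - x))\<^sup>2)
        \<le> ereal (c + d \<bullet> (p - x)) + ereal r + ereal (L / 2 * (norm (p - x))\<^sup>2)"
      using pr by (intro add_right_mono add_left_mono) (simp add: S_def ereal_epigraph_def)
    ultimately show ?thesis
      using real by (auto simp: m_def intro: order_trans)
  qed (use assms(2) in \<open>auto simp: proper_fun_def\<close>)
  then show ?thesis by blast
qed

section \<open>The prox-grad inequality and subgradients for \<open>f + g\<close>\<close>

locale composite_problem =
  fixes L :: real and f :: "'a::euclidean_space \<Rightarrow> real" and g :: "'a \<Rightarrow> ereal" and xstar :: 'a
  assumes L_pos: "L > 0"
    and f_convex: "convex_on UNIV f" and f_smooth: "smooth_with L f"
    and g_closed: "closed_fun g" and g_convex: "convex_fun g" and g_proper: "proper_fun g"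
    and minimizer: "ereal (f xstar) + g xstar \<le> ereal (f x) + g x"
begin

abbreviation T :: "'a \<Rightarrow> 'a" where
  "T \<equiv> prox_grad L f g"

text \<open>Meaningful only where \<open>g\<close> is finite, since \<open>real_of_ereal\<close>
  sends infinity to 0; hence the domain later given to \<open>prox_step\<close>.\<close>

definition objective :: "'a \<Rightarrow> real" where
  "objective x = f x + real_of_ereal (g x)"

lemma gderiv: "GDERIV f x :> gradient f x"
  using f_smooth by (intro GDERIV_gradient) (simp add: smooth_with_def)

lemma xstar_finite: "\<bar>g xstar\<bar> \<noteq> \<infinity>"
  using finite_at_minimizer[where q = f, OF g_proper minimizer] .

text \<open>\<open>arg_min_on\<close> is a choice, informative only once a minimizer exists.
  Optimality of \<open>xstar\<close> supplies the subgradient of \<open>g\<close> that existence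
  needs.\<close>

lemma prox_grad_minimal:
  "ereal (f x + gradient f x \<bullet> (T x - x)) + g (T x) + ereal (L / 2 * (norm (T x - x))\<^sup>2)
    \<le> ereal (f x + gradient f x \<bullet> (y - x)) + g y + ereal (L / 2 * (norm (y - x))\<^sup>2)"
proof -
  have "- gradient f xstar \<in> subdifferential g xstar"
    by (rule minimizer_subgradient[OF g_proper g_convex gderiv minimizer])
  from prox_model_attains_min[OF L_pos g_proper g_closed xstar_finite this]
  obtain p where "\<And>y. ereal (f x + gradient f x \<bullet> (p - x)) + g p + ereal (L / 2 * (norm (p - x))\<^sup>2)
      \<le> ereal (f x + gradient f x \<bullet> (y - x)) + g y + ereal (L / 2 * (norm (y - x))\<^sup>2)"
    by blast
  then have "\<exists>p. is_arg_min (\<lambda>y. ereal (f x + gradient f x \<bullet> (y - x)) + g y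
                     + ereal (L / 2 * (norm (y - x))\<^sup>2)) (\<lambda>y. y \<in> UNIV) p"
    unfolding is_arg_min_linorder by blast
  from someI_ex[OF this] show ?thesis
    unfolding prox_grad_def arg_min_on_def arg_min_def is_arg_min_linorder by blast
qed

lemma prox_grad_optimality:
  "\<bar>g (T x)\<bar> \<noteq> \<infinity>"
  "L *\<^sub>R (x - T x) - gradient f x \<in> subdifferential g (T x)"
proof -
  define q where "q y = f x + gradient f x \<bullet> (y - x) + L / 2 * (norm (y - x))\<^sup>2" for y
  have split: "ereal (f x + gradient f x \<bullet> (y - x)) + g y + ereal (L / 2 * (norm (y - x))\<^sup>2)
      = ereal (q y) + g y" for y
    by (cases "g y") (simp_all add: q_def)
  have min: "ereal (q (T x)) + g (T x) \<le> ereal (q y) + g y" for y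
    using prox_grad_minimal[of x y] unfolding split .
  then show "\<bar>g (T x)\<bar> \<noteq> \<infinity>"
    by (rule finite_at_minimizer[OF g_proper])
  have "GDERIV q (T x) :> gradient f x + L *\<^sub>R (T x - x)"
    unfolding gderiv_def q_def power2_norm_eq_inner
    by (auto intro!: derivative_eq_intros simp: inner_simps inner_commute algebra_simps)
  from minimizer_subgradient[OF g_proper g_convex this min]
  show "L *\<^sub>R (x - T x) - gradient f x \<in> subdifferential g (T x)"
    by (simp add: algebra_simps)
qed

text \<open>Three inequalities add up: the subgradient of \<open>g\<close> at \<open>T x\<close>,
  the tangent of \<open>f\<close> at x, and the descent lemma from x to \<open>T x\<close>.\<close>

lemma prox_grad_le:
  assumes "\<bar>g y\<bar> \<noteq> \<infinity>"
  shows "objective (T x) + L * ((x - T x) \<bullet> (y - x)) + L / 2 * (norm (x - T x))\<^sup>2 \<le> objective y"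
proof -
  obtain a b where ab: "g (T x) = ereal a" "g y = ereal b"
    using assms prox_grad_optimality(1)[of x] by auto
  have "g (T x) + ereal ((L *\<^sub>R (x - T x) - gradient f x) \<bullet> (y - T x)) \<le> g y"
    using prox_grad_optimality(2)[of x] by (simp add: subdifferential_def)
  then have "a + (L *\<^sub>R (x - T x) - gradient f x) \<bullet> (y - T x) \<le> b"
    by (simp add: ab)
  moreover have "f x + gradient f x \<bullet> (y - x) \<le> f y"
    by (rule convex_gradient_le[OF f_convex gderiv])
  moreover have "f (T x) \<le> f x + gradient f x \<bullet> (T x - x) + L / 2 * (norm (x - T x))\<^sup>2"
    using smooth_upper_bound[OF f_smooth, of "T x" x] by (simp add: norm_minus_commute)
  moreover have "(L *\<^sub>R (x - T x) - gradient f x) \<bullet> (y - T x)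
      = L * ((x - T x) \<bullet> (y - x)) + L * (norm (x - T x))\<^sup>2
        - gradient f x \<bullet> (y - x) + gradient f x \<bullet> (T x - x)"
    unfolding power2_norm_eq_inner by (simp add: inner_simps inner_commute algebra_simps)
  ultimately show ?thesis
    by (simp add: objective_def ab)
qed

lemma objective_minimal:
  assumes "\<bar>g x\<bar> \<noteq> \<infinity>"
  shows "objective xstar \<le> objective x"
  using assms xstar_finite minimizer[of x] by (auto simp: objective_def)

text \<open>The easy half of the sum rule: the gradient of \<open>f\<close> at \<open>T x\<close>
  plus the subgradient of \<open>g\<close> from \<open>prox_grad_optimality\<close>.\<close>

lemma subgradient_at_prox_grad:
  "gradient f (T x) - gradient f x + L *\<^sub>R (x - T x) \<in> subdifferential (\<lambda>y. ereal (f y) + g y) (T x)"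
  unfolding subdifferential_def
proof (intro CollectI allI)
  fix y
  obtain a where a: "g (T x) = ereal a"
    using prox_grad_optimality(1)[of x] by auto
  have 1: "g (T x) + ereal ((L *\<^sub>R (x - T x) - gradient f x) \<bullet> (y - T x)) \<le> g y"
    using prox_grad_optimality(2)[of x] by (simp add: subdifferential_def)
  have 2: "f (T x) + gradient f (T x) \<bullet> (y - T x) \<le> f y"
    by (rule convex_gradient_le[OF f_convex gderiv])
  show "ereal (f (T x)) + g (T x) + ereal ((gradient f (T x) - gradient f x + L *\<^sub>R (x - T x)) \<bullet> (y - T x))
      \<le> ereal (f y) + g y"
    using 1 2 by (cases "g y") (auto simp: a inner_diff_left inner_add_left)
qed

text \<open>A closed nonempty set has an element of least norm. The explicit subgradient has norm at
  most 2 L times that of x - T x: one L from the Lipschitz gradient, one from the step.\<close>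

lemma min_norm_subgradient:
  "\<exists>u. is_arg_min (\<lambda>v. (norm v)\<^sup>2) (\<lambda>v. v \<in> subdifferential (\<lambda>y. ereal (f y) + g y) (T x)) u
     \<and> (norm u)\<^sup>2 \<le> 4 * (norm (grad_mapping L f g x))\<^sup>2"
proof -
  let ?S = "subdifferential (\<lambda>y. ereal (f y) + g y) (T x)"
  let ?v = "gradient f (T x) - gradient f x + L *\<^sub>R (x - T x)"
  obtain a where a: "g (T x) = ereal a"
    using prox_grad_optimality(1)[of x] by auto
  have "?S = (\<Inter>y. {u. ereal (f (T x) + a + u \<bullet> (y - T x)) \<le> ereal (f y) + g y})"
    by (auto simp: subdifferential_def a)
  moreover have "closed \<dots>"
    by (intro closed_INT ballI closed_Collect_le continuous_intros)
  ultimately have "closed ?S" by simp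
  then obtain u where u: "u \<in> ?S" "\<And>v. v \<in> ?S \<Longrightarrow> norm u \<le> norm v"
    using distance_attains_inf[of ?S 0] subgradient_at_prox_grad[of x] by (auto simp: dist_norm)
  have "norm u \<le> norm ?v"
    by (intro u subgradient_at_prox_grad)
  also have "\<dots> \<le> norm (gradient f (T x) - gradient f x) + norm (L *\<^sub>R (x - T x))"
    by (rule norm_triangle_ineq)
  also have "norm (gradient f (T x) - gradient f x) \<le> L * norm (T x - x)"
    using f_smooth lipschitz_onD[of L UNIV "gradient f" "T x" x] by (auto simp: smooth_with_def dist_norm)
  finally have "norm u \<le> 2 * norm (grad_mapping L f g x)"
    using L_pos by (simp add: grad_mapping_def norm_minus_commute)
  then have "(norm u)\<^sup>2 \<le> (2 * norm (grad_mapping L f g x))\<^sup>2"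
    by (intro power_mono) auto
  moreover have "is_arg_min (\<lambda>v. (norm v)\<^sup>2) (\<lambda>v. v \<in> ?S) u"
    using u by (auto simp: is_arg_min_linorder intro: power_mono)
  ultimately show ?thesis
    by (auto simp: power_mult_distrib)
qed

end

theorem corollary1:
  fixes L :: real
    and f :: "real ^ 'n \<Rightarrow> real"
    and g F :: "real ^ 'n \<Rightarrow> ereal"
    and K :: nat
    and x0 xstar x2K :: "real ^ 'n"
  assumes "L > 0"
    and "convex_on UNIV f"
    and "smooth_with L f"
    and "closed_fun g"
    and "convex_fun g"
    and "proper_fun g"
    and "F = (\<lambda>x. ereal (f x) + g x)"
    and "\<forall>x. F xstar \<le> F x"
    and "K \<ge> 1"
    and "x2K = fista_fista_g L f g K x0"
  shows "(\<exists>u. is_arg_min (\<lambda>v. (norm v)\<^sup>2)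
                 (\<lambda>v. v \<in> subdifferential F (prox_grad L f g x2K)) u
             \<and> (norm u)\<^sup>2 \<le> 4 * (norm (grad_mapping L f g x2K))\<^sup>2)
         \<and> 4 * (norm (grad_mapping L f g x2K))\<^sup>2
             \<le> 528 * L\<^sup>2 / (real K + 2) ^ 4 * (norm (x0 - xstar))\<^sup>2"
proof -
  interpret composite_problem L f g xstar
    using assms by unfold_locales auto
  interpret prox_step T objective "{x. \<bar>g x\<bar> \<noteq> \<infinity>}" L
    by unfold_locales (use L_pos prox_grad_optimality(1) prox_grad_le in auto)
  define w0 where "w0 = T (fista L f g x0 K)"
  have w0: "\<bar>g w0\<bar> \<noteq> \<infinity>"
    unfolding w0_def by (rule prox_grad_optimality(1))
  have x2K: "x2K = fista_g L f g K w0 K"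
    by (simp add: assms w0_def fista_fista_g_def)
  have first: "objective w0 - objective xstar \<le> 2 * L / (real K + 2)\<^sup>2 * (norm (x0 - xstar))\<^sup>2"
    unfolding w0_def fista_def by (rule fista_rate[OF _ refl]) (use xstar_finite in simp)
  have "L / 2 * (norm (x2K - T x2K))\<^sup>2 \<le> phi_weight K * (objective w0 - objective (T x2K))"
    unfolding x2K fista_g_def by (rule fista_g_step) (use w0 in simp)
  also have "\<dots> \<le> phi_weight K * (objective w0 - objective xstar)"
    using objective_minimal[OF prox_grad_optimality(1)[of x2K]] phi_weight_pos[of K]
    by (intro mult_left_mono) auto
  \<comment> \<open>The available constant 30 is relaxed to 33 so that, after multiplication by 8 L
    below, 8 * 33 * 2 = 528.\<close>
  also have "\<dots> \<le> 33 / (real K + 2)\<^sup>2 * (2 * L / (real K + 2)\<^sup>2 * (norm (x0 - xstar))\<^sup>2)"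
  proof (rule mult_mono)
    show "phi_weight K \<le> 33 / (real K + 2)\<^sup>2"
      by (rule order_trans[OF phi_weight_le]) (simp add: divide_right_mono)
  qed (use first objective_minimal[OF w0] in auto)
  finally have "8 * L * (L / 2 * (norm (x2K - T x2K))\<^sup>2)
      \<le> 8 * L * (33 / (real K + 2)\<^sup>2 * (2 * L / (real K + 2)\<^sup>2 * (norm (x0 - xstar))\<^sup>2))"
    using L_pos by (intro mult_left_mono) auto
  moreover have "8 * L * (L / 2 * (norm (x2K - T x2K))\<^sup>2) = 4 * (norm (grad_mapping L f g x2K))\<^sup>2"
    by (simp add: grad_mapping_def norm_minus_commute power_mult_distrib power2_eq_square)
  moreover have "8 * L * (33 / (real K + 2)\<^sup>2 * (2 * L / (real K + 2)\<^sup>2 * (norm (x0 - xstar))\<^sup>2))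
      = 528 * L\<^sup>2 / (real K + 2) ^ 4 * (norm (x0 - xstar))\<^sup>2"
    by (simp add: power2_eq_square power4_eq_xxxx mult.assoc)
  moreover have "F = (\<lambda>y. ereal (f y) + g y)"
    by (rule assms)
  ultimately show ?thesis
    using min_norm_subgradient[of x2K] by (simp only: simp_thms)
qed

end
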